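(* Let $n\ge 1$ and let $f:\mathbb{D}^n\to\mathbb{D}$ be holomorphic. If the extreme set $X(f)$ has nonempty interior, then $X(f)=\mathbb{D}^n$ (i.e. $f$ is everywhere infinitesimally extremal).
   Context: $\mathbb{D}=\{\zeta\in\mathbb{C}:|\zeta|<1\}$ is the open unit disk and $\mathbb{D}^n$ is the polydisk. For a holomorphic function $f:\mathbb{D}^n\to\mathbb{D}$, the extreme set of $f$ is $$X(f):=\left\{z\in\mathbb{D}^n : 1-|f(z)|^2=\sum_{i=1}^n(1-|z_i|^2)\left|\frac{\partial f}{\partial z_i}(z)\right|\right\}.$$ The function $f$ is called everywhere infinitesimally extremal if $X(f)=\mathbb{D}^n$. *)

theory Defs
  imports "HOL-Complex_Analysis.Complex_Analysis"
begin

definition polydisk :: "(complex ^ 'n) set"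
  where "polydisk = {z. \<forall>i. z $ i \<in> ball 0 1}"

text \<open>
  Holomorphy in several variables as complex Frechet differentiability: the real derivative
  exists at every point and is complex linear. The set is meant to be open.
\<close>

definition holomorphic_several_on :: "(complex ^ 'n \<Rightarrow> complex) \<Rightarrow> (complex ^ 'n) set \<Rightarrow> bool"
    (infixl "(holomorphic'_several'_on)" 50)
  where "f holomorphic_several_on S \<longleftrightarrow>
    (\<forall>z\<in>S. \<exists>f'. (f has_derivative f') (at z) \<and> (\<forall>c h. f' (c *s h) = c * f' h))"

definition partial_deriv :: "'n \<Rightarrow> (complex ^ 'n \<Rightarrow> complex) \<Rightarrow> complex ^ 'n \<Rightarrow> complex"
  where "partial_deriv i f z = deriv (\<lambda>w. f (\<chi> j. if j = i then w else z $ j)) (z $ i)"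

definition extreme_set :: "(complex ^ 'n \<Rightarrow> complex) \<Rightarrow> (complex ^ 'n) set"
  where "extreme_set f = {z \<in> polydisk.
    1 - (cmod (f z))\<^sup>2 = (\<Sum>i\<in>UNIV. (1 - (cmod (z $ i))\<^sup>2) * cmod (partial_deriv i f z))}"

definition everywhere_infinitesimally_extremal :: "(complex ^ 'n \<Rightarrow> complex) \<Rightarrow> bool"
  where "everywhere_infinitesimally_extremal f \<longleftrightarrow> extreme_set f = polydisk"

end

theory Submission
  imports Defs
begin

text \<open>
  The equation defining the extreme set says that a real linear combination of the moduli of the
  functions \<open>1\<close>, \<open>f\<^sup>2\<close>, \<open>\<partial>\<^sub>i f\<close> and \<open>z\<^sub>i\<^sup>2 \<partial>\<^sub>i f\<close> vanishes. Such a combination has the identity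
  property of analytic functions: along a complex line, off the sparse set of zeros, each modulus
  is locally \<open>s * cnj s\<close> with \<open>s\<close> a holomorphic square root, and an identity
  \<open>\<Sum>\<^sub>k a\<^sub>k(z) cnj (b\<^sub>k(z)) = 0\<close> polarizes to \<open>\<Sum>\<^sub>k a\<^sub>k(z) cnj (b\<^sub>k(w)) = 0\<close>, which continues
  analytically in \<open>z\<close> and \<open>w\<close> separately. A sparse set does not disconnect a planar domain, and
  continuity takes care of the zeros themselves.
\<close>

section \<open>Linear combinations of moduli of holomorphic functions\<close>

lemma of_real_islimpt_Reals: "of_real x islimpt (\<real> :: 'a :: real_normed_algebra_1 set)"
  unfolding islimpt_approachable
proof (intro allI impI)
  fix \<epsilon> :: real assume "0 < \<epsilon>"
  then show "\<exists>y\<in>\<real>. y \<noteq> (of_real x :: 'a) \<and> dist y (of_real x) < \<epsilon>"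
    by (intro bexI[of _ "of_real (x + \<epsilon> / 2)"]) (auto simp: dist_norm)
qed

lemma convex_affine_vimage:
  assumes "convex S" "linear g"
  shows "convex ((\<lambda>x. a + g x) -` S)"
proof -
  have "(\<lambda>x. a + g x) -` S = g -` ((\<lambda>y. y - a) ` S)"
    by (force simp: image_iff)
  then show ?thesis
    using assms by (simp add: convex_linear_vimage convex_translation_subtract)
qed

lemma sum_mult_cnj_polarization_real_axis:
  fixes a b :: "'k \<Rightarrow> complex \<Rightarrow> complex"
  assumes M: "open M" "convex M"
    and a: "\<And>k. k \<in> K \<Longrightarrow> a k holomorphic_on M"
    and b: "\<And>k. k \<in> K \<Longrightarrow> b k holomorphic_on M"
    and real_axis: "\<And>s. s \<in> \<real> \<Longrightarrow> s \<in> M \<Longrightarrow> (\<Sum>k\<in>K. a k s * cnj (b k s)) = 0"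
    and t: "t \<in> M" "cnj t \<in> M"
  shows "(\<Sum>k\<in>K. a k t * cnj (b k (cnj t))) = 0"
proof -
  define N where "N = M \<inter> cnj -` M"
  have open_vimage_cnj: "open (cnj -` M)"
    using M(1) by (intro open_vimage continuous_intros)
  then have "open N"
    using M(1) by (simp add: N_def open_Int)
  have "convex N"
    unfolding N_def using M(2)
    by (intro convex_Int convex_linear_vimage bounded_linear.linear bounded_linear_cnj)
  have "complex_of_real (Re t) = (1 / 2) *\<^sub>R t + (1 / 2) *\<^sub>R cnj t"
    by (simp add: complex_eq_iff)
  also have "\<dots> \<in> M"
    using M(2) t by (intro convexD) auto
  finally have Re_t: "complex_of_real (Re t) \<in> N"
    by (simp add: N_def)
  have b_cnj: "(\<lambda>s. cnj (b k (cnj s))) holomorphic_on cnj -` M" if "k \<in> K" for k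
    using holomorphic_on_compose_cnj_cnj[of "b k" "cnj -` M"] b[OF that] open_vimage_cnj
    by (simp add: o_def image_cnj_conv_vimage_cnj vimage_def)
  have hol: "(\<lambda>s. \<Sum>k\<in>K. a k s * cnj (b k (cnj s))) holomorphic_on N"
    unfolding N_def
    by (intro holomorphic_intros)
      (auto intro: holomorphic_on_subset[OF a] holomorphic_on_subset[OF b_cnj])
  show ?thesis
  proof (rule analytic_continuation[OF hol \<open>open N\<close>, where U = "\<real> \<inter> N"])
    show "complex_of_real (Re t) islimpt \<real> \<inter> N"
      by (intro islimpt_Int_eventually of_real_islimpt_Reals eventually_at_in_open'
          \<open>open N\<close> Re_t)
    show "(\<Sum>k\<in>K. a k s * cnj (b k (cnj s))) = 0" if "s \<in> \<real> \<inter> N" for s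
      using that real_axis[of s] by (auto simp: N_def Reals_cnj_iff)
  qed (use Re_t t \<open>convex N\<close> in \<open>auto simp: N_def convex_connected\<close>)
qed

lemma sum_mult_cnj_polarization:
  fixes a b :: "'k \<Rightarrow> complex \<Rightarrow> complex"
  assumes S: "open S" "convex S"
    and a: "\<And>k. k \<in> K \<Longrightarrow> a k holomorphic_on S"
    and b: "\<And>k. k \<in> K \<Longrightarrow> b k holomorphic_on S"
    and diagonal: "\<And>z. z \<in> S \<Longrightarrow> (\<Sum>k\<in>K. a k z * cnj (b k z)) = 0"
    and zw: "z \<in> S" "w \<in> S"
  shows "(\<Sum>k\<in>K. a k z * cnj (b k w)) = 0"
proof -
  \<comment> \<open>This affine map sends \<open>\<i>\<close> to \<open>z\<close> and \<open>cnj \<i>\<close> to \<open>w\<close>.\<close>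
  define L where "L t = (z + w) / 2 + t * ((z - w) / (2 * \<i>))" for t
  have L_ii: "L \<i> = z" "L (cnj \<i>) = w"
    by (simp_all add: L_def field_simps)
  have L_hol: "L holomorphic_on A" for A
    unfolding L_def by (intro holomorphic_intros) auto
  have "(\<Sum>k\<in>K. a k (L \<i>) * cnj (b k (L (cnj \<i>)))) = 0"
  proof (rule sum_mult_cnj_polarization_real_axis[where M = "L -` S"])
    show "open (L -` S)"
      by (intro open_vimage S holomorphic_on_imp_continuous_on L_hol)
    show "convex (L -` S)"
      unfolding L_def
      by (intro convex_affine_vimage S bounded_linear.linear bounded_linear_mult_left)
    show "(\<lambda>t. a k (L t)) holomorphic_on L -` S" if "k \<in> K" for k
      using holomorphic_on_compose_gen[OF L_hol a[OF that]] by (auto simp: o_def)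
    show "(\<lambda>t. b k (L t)) holomorphic_on L -` S" if "k \<in> K" for k
      using holomorphic_on_compose_gen[OF L_hol b[OF that]] by (auto simp: o_def)
  qed (use diagonal zw L_ii in auto)
  then show ?thesis
    unfolding L_ii .
qed

theorem sum_mult_cnj_eq_0:
  fixes a b :: "'k \<Rightarrow> complex \<Rightarrow> complex"
  assumes S: "open S" "connected S"
    and a: "\<And>k. k \<in> K \<Longrightarrow> a k holomorphic_on S"
    and b: "\<And>k. k \<in> K \<Longrightarrow> b k holomorphic_on S"
    and V: "open V" "V \<noteq> {}" "V \<subseteq> S"
    and vanishes: "\<And>z. z \<in> V \<Longrightarrow> (\<Sum>k\<in>K. a k z * cnj (b k z)) = 0"
    and "p \<in> S"
  shows "(\<Sum>k\<in>K. a k p * cnj (b k p)) = 0"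
proof -
  obtain q r where "0 < r" and r: "ball q r \<subseteq> V"
    using V open_contains_ball by blast
  have ball_S: "ball q r \<subseteq> S" and ball_nonempty: "ball q r \<noteq> {}"
    using r V(3) \<open>0 < r\<close> by auto
  have polarized: "(\<Sum>k\<in>K. a k z * cnj (b k w)) = 0" if "z \<in> ball q r" "w \<in> ball q r" for z w
  proof (rule sum_mult_cnj_polarization[of "ball q r"])
    show "a k holomorphic_on ball q r" "b k holomorphic_on ball q r" if "k \<in> K" for k
      using a[OF that] b[OF that] ball_S by (auto intro: holomorphic_on_subset)
  qed (use that vanishes r in auto)
  have "(\<Sum>k\<in>K. a k p * cnj (b k w)) = 0" if "w \<in> ball q r" for w
    by (rule analytic_continuation_open[OF open_ball S(1) ball_nonempty S(2) ball_S _ _ _ \<open>p \<in> S\<close>])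
      (use polarized that a in \<open>auto intro!: holomorphic_intros\<close>)
  then have conjugated: "(\<Sum>k\<in>K. cnj (a k p) * b k w) = 0" if "w \<in> ball q r" for w
    using that by (subst complex_cnj_cancel_iff[symmetric]) simp
  have "(\<Sum>k\<in>K. cnj (a k p) * b k p) = 0"
    by (rule analytic_continuation_open[OF open_ball S(1) ball_nonempty S(2) ball_S _ _ _ \<open>p \<in> S\<close>])
      (use conjugated b in \<open>auto intro!: holomorphic_intros\<close>)
  then show ?thesis
    by (subst complex_cnj_cancel_iff[symmetric]) simp
qed

lemma sum_norm_holomorphic_eq_0_contractible:
  fixes G :: "'k \<Rightarrow> complex \<Rightarrow> complex" and c :: "'k \<Rightarrow> real"
  assumes S: "open S" "contractible S"
    and hol: "\<And>k. k \<in> K \<Longrightarrow> G k holomorphic_on S"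
    and zeros: "\<And>k. k \<in> K \<Longrightarrow> (\<forall>z\<in>S. G k z = 0) \<or> (\<forall>z\<in>S. G k z \<noteq> 0)"
    and V: "open V" "V \<noteq> {}" "V \<subseteq> S"
    and vanishes: "\<And>z. z \<in> V \<Longrightarrow> (\<Sum>k\<in>K. c k * cmod (G k z)) = 0"
    and "p \<in> S"
  shows "(\<Sum>k\<in>K. c k * cmod (G k p)) = 0"
proof -
  have "\<exists>s. s holomorphic_on S \<and> (\<forall>z\<in>S. G k z = (s z)\<^sup>2)" if "k \<in> K" for k
    using zeros[OF that]
  proof
    assume "\<forall>z\<in>S. G k z = 0"
    then show ?thesis
      by (intro exI[of _ "\<lambda>_. 0"]) auto
  next
    assume "\<forall>z\<in>S. G k z \<noteq> 0"
    then show ?thesis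
      using contractible_imp_holomorphic_sqrt[OF hol[OF that] S(2)] by metis
  qed
  then obtain s where s: "\<And>k. k \<in> K \<Longrightarrow> s k holomorphic_on S"
      "\<And>k z. k \<in> K \<Longrightarrow> z \<in> S \<Longrightarrow> G k z = (s k z)\<^sup>2"
    by metis
  have sum_eq: "complex_of_real (\<Sum>k\<in>K. c k * cmod (G k z)) =
      (\<Sum>k\<in>K. (of_real (c k) * s k z) * cnj (s k z))" if "z \<in> S" for z
    using s(2)[OF _ that]
    by (auto simp: norm_power complex_norm_square mult.assoc simp del: of_real_power
        intro!: sum.cong)
  have "(\<Sum>k\<in>K. (of_real (c k) * s k p) * cnj (s k p)) = 0"
    using S(1) contractible_imp_connected[OF S(2)] _ s(1) V _ \<open>p \<in> S\<close>
  proof (rule sum_mult_cnj_eq_0)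
    show "(\<Sum>k\<in>K. (of_real (c k) * s k z) * cnj (s k z)) = 0" if "z \<in> V" for z
      using vanishes[OF that] sum_eq[of z] that V(3) by auto
  qed (auto intro: holomorphic_intros s(1))
  then show ?thesis
    using sum_eq[OF \<open>p \<in> S\<close>] by (simp only: of_real_eq_0_iff)
qed

lemma sum_norm_holomorphic_eq_0_zero_free:
  fixes G :: "'k \<Rightarrow> complex \<Rightarrow> complex" and c :: "'k \<Rightarrow> real"
  assumes S: "open S" "connected S"
    and hol: "\<And>k. k \<in> K \<Longrightarrow> G k holomorphic_on S"
    and zeros: "\<And>k. k \<in> K \<Longrightarrow> (\<forall>z\<in>S. G k z = 0) \<or> (\<forall>z\<in>S. G k z \<noteq> 0)"
    and V: "open V" "V \<noteq> {}" "V \<subseteq> S"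
    and vanishes: "\<And>z. z \<in> V \<Longrightarrow> (\<Sum>k\<in>K. c k * cmod (G k z)) = 0"
    and "p \<in> S"
  shows "(\<Sum>k\<in>K. c k * cmod (G k p)) = 0"
proof -
  define D where "D z = (\<Sum>k\<in>K. c k * cmod (G k z))" for z
  obtain q where "q \<in> V"
    using V(2) by blast
  define vanishes_near where "vanishes_near y \<longleftrightarrow> (\<forall>\<^sub>F z in nhds y. D z = 0)" for y
  have "vanishes_near p"
    using S(2)
  proof (rule connected_induction_simple)
    show "q \<in> S" "p \<in> S"
      using V(3) \<open>q \<in> V\<close> \<open>p \<in> S\<close> by auto
    show "vanishes_near q"
      using V(1) \<open>q \<in> V\<close> vanishes by (auto simp: vanishes_near_def D_def eventually_nhds)
    fix x assume "x \<in> S"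
    then obtain r where "0 < r" and r: "ball x r \<subseteq> S"
      using S(1) openE by blast
    have "vanishes_near z" if y: "y \<in> ball x r" "vanishes_near y" and z: "z \<in> ball x r" for y z
    proof -
      obtain W where W: "open W" "y \<in> W" "\<And>u. u \<in> W \<Longrightarrow> D u = 0"
        using y(2) by (auto simp: vanishes_near_def eventually_nhds)
      have "D u = 0" if "u \<in> ball x r" for u
        unfolding D_def
      proof (rule sum_norm_holomorphic_eq_0_contractible
          [where S = "ball x r" and V = "W \<inter> ball x r"])
        show "(\<forall>u\<in>ball x r. G k u = 0) \<or> (\<forall>u\<in>ball x r. G k u \<noteq> 0)" if "k \<in> K" for k
          using zeros[OF that] r by blast
        show "G k holomorphic_on ball x r" if "k \<in> K" for k
          using hol[OF that] r by (rule holomorphic_on_subset)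
      qed (use that W y(1) in \<open>auto simp: D_def convex_imp_contractible\<close>)
      then show ?thesis
        unfolding vanishes_near_def
        by (rule eventually_mono[OF eventually_nhds_in_open[OF open_ball z]])
    qed
    moreover have "openin (top_of_set S) (ball x r)" "x \<in> ball x r"
      using \<open>0 < r\<close> r by (auto simp: open_subset)
    ultimately show "\<exists>T. openin (top_of_set S) T \<and> x \<in> T \<and>
        (\<forall>y\<in>T. \<forall>z\<in>T. vanishes_near y \<longrightarrow> vanishes_near z)"
      by blast
  qed
  then show ?thesis
    unfolding vanishes_near_def D_def by (rule eventually_nhds_x_imp_x)
qed

lemma sparse_in_zeros_holomorphic:
  assumes "f holomorphic_on S" "open S" "connected S" "\<beta> \<in> S" "f \<beta> \<noteq> 0"
  shows "{z \<in> S. f z = 0} sparse_in S"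
  unfolding sparse_in_eventually_iff[OF \<open>open S\<close>]
proof
  fix z assume "z \<in> S"
  from non_zero_neighbour_alt[OF assms(1-3) this assms(4,5)]
  show "\<forall>\<^sub>F w in at z. w \<notin> {z \<in> S. f z = 0}"
    by eventually_elim auto
qed

theorem sum_norm_holomorphic_eq_0:
  fixes G :: "'k \<Rightarrow> complex \<Rightarrow> complex" and c :: "'k \<Rightarrow> real"
  assumes S: "open S" "connected S" and "finite K"
    and hol: "\<And>k. k \<in> K \<Longrightarrow> G k holomorphic_on S"
    and V: "open V" "V \<noteq> {}" "V \<subseteq> S"
    and vanishes: "\<And>z. z \<in> V \<Longrightarrow> (\<Sum>k\<in>K. c k * cmod (G k z)) = 0"
    and "p \<in> S"
  shows "(\<Sum>k\<in>K. c k * cmod (G k p)) = 0"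
proof -
  define D where "D z = (\<Sum>k\<in>K. c k * cmod (G k z))" for z
  define Z where "Z = (\<Union>k\<in>{k \<in> K. \<exists>z\<in>S. G k z \<noteq> 0}. {z \<in> S. G k z = 0})"
  have sparse: "Z sparse_in S"
    unfolding Z_def using \<open>finite K\<close>
    by (intro sparse_in_UN_finite) (auto intro: sparse_in_zeros_holomorphic hol S)
  have not_in_Z: "\<forall>\<^sub>F z in at x. z \<notin> Z" if "x \<in> S" for x
    using sparse that sparse_in_eventually_iff[OF S(1)] by blast
  have off_Z: "D z = 0" if "z \<in> S - Z" for z
    unfolding D_def
  proof (rule sum_norm_holomorphic_eq_0_zero_free[where S = "S - Z" and V = "V - Z"])
    show "open (S - Z)" "connected (S - Z)"
      using S sparse by (auto intro: open_diff_sparse_pts sparse_imp_connected)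
    show "open (V - Z)"
      using V sparse by (auto intro: open_diff_sparse_pts sparse_in_subset)
    obtain q where "q \<in> V"
      using V(2) by blast
    then have "\<forall>\<^sub>F z in at q. z \<in> V \<and> z \<notin> Z"
      using V(1,3) not_in_Z by (intro eventually_conj eventually_at_in_open') auto
    then show "V - Z \<noteq> {}"
      using eventually_happens'[OF at_neq_bot] by blast
    show "G k holomorphic_on S - Z" if "k \<in> K" for k
      using hol[OF that] by (auto intro: holomorphic_on_subset)
    show "(\<forall>z\<in>S - Z. G k z = 0) \<or> (\<forall>z\<in>S - Z. G k z \<noteq> 0)" if "k \<in> K" for k
      using that by (auto simp: Z_def)
  qed (use that V(3) vanishes in auto)
  have "\<forall>\<^sub>F z in at p. D z = 0"
    using not_in_Z[OF \<open>p \<in> S\<close>] eventually_at_in_open'[OF S(1) \<open>p \<in> S\<close>]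
    by eventually_elim (use off_Z in auto)
  moreover have "continuous_on S D"
    unfolding D_def by (intro continuous_intros holomorphic_on_imp_continuous_on hol)
  then have "isCont D p"
    using S(1) \<open>p \<in> S\<close> by (simp add: continuous_on_eq_continuous_at)
  ultimately have "D p = 0"
    using tendsto_unique[OF at_neq_bot] tendsto_eventually by (metis isCont_def)
  then show ?thesis
    unfolding D_def .
qed

section \<open>Holomorphy along complex lines\<close>

definition gateaux_holomorphic_on :: "(complex ^ 'n \<Rightarrow> complex) \<Rightarrow> (complex ^ 'n) set \<Rightarrow> bool"
    (infixl "(gateaux'_holomorphic'_on)" 50)
  where "f gateaux_holomorphic_on S \<longleftrightarrow>
    (\<forall>a b. (\<lambda>\<zeta>. f (a + \<zeta> *s b)) holomorphic_on {\<zeta>. a + \<zeta> *s b \<in> S})"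

lemma gateaux_holomorphic_onD:
  assumes "f gateaux_holomorphic_on S" "\<And>\<zeta>. \<zeta> \<in> T \<Longrightarrow> a + \<zeta> *s b \<in> S"
  shows "(\<lambda>\<zeta>. f (a + \<zeta> *s b)) holomorphic_on T"
  using assms holomorphic_on_subset unfolding gateaux_holomorphic_on_def by blast

lemma gateaux_holomorphic_on_const: "(\<lambda>_. c) gateaux_holomorphic_on S"
  by (simp add: gateaux_holomorphic_on_def)

lemma gateaux_holomorphic_on_nth: "(\<lambda>z. z $ i) gateaux_holomorphic_on S"
  by (auto simp: gateaux_holomorphic_on_def intro!: holomorphic_intros)

lemma gateaux_holomorphic_on_mult:
  assumes "f gateaux_holomorphic_on S" "g gateaux_holomorphic_on S"
  shows "(\<lambda>z. f z * g z) gateaux_holomorphic_on S"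
  using assms by (auto simp: gateaux_holomorphic_on_def intro!: holomorphic_intros)

lemma gateaux_holomorphic_on_power:
  assumes "f gateaux_holomorphic_on S"
  shows "(\<lambda>z. f z ^ n) gateaux_holomorphic_on S"
  using assms by (auto simp: gateaux_holomorphic_on_def intro!: holomorphic_intros)

lemma linear_vector_scale: "linear (\<lambda>\<zeta>. \<zeta> *s (b :: complex ^ 'n))"
  by (rule linearI) (simp_all add: vec_eq_iff algebra_simps)

lemma holomorphic_several_on_imp_gateaux_holomorphic_on:
  assumes "f holomorphic_several_on S"
  shows "f gateaux_holomorphic_on S"
  unfolding gateaux_holomorphic_on_def holomorphic_on_def
proof (intro allI ballI)
  fix a b and \<zeta> assume "\<zeta> \<in> {\<zeta>. a + \<zeta> *s b \<in> S}"
  with assms obtain f' where f': "(f has_derivative f') (at (a + \<zeta> *s b))"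
      "\<And>c h. f' (c *s h) = c * f' h"
    unfolding holomorphic_several_on_def by blast
  have "((\<lambda>\<zeta>. a + \<zeta> *s b) has_derivative (\<lambda>\<zeta>. \<zeta> *s b)) (at \<zeta>)"
    by (auto intro!: derivative_eq_intros linear_imp_has_derivative linear_vector_scale)
  from has_derivative_compose[OF this f'(1)]
  have "((\<lambda>\<zeta>. f (a + \<zeta> *s b)) has_field_derivative f' b) (at \<zeta>)"
    by (simp add: has_field_derivative_def f'(2) mult.commute[of _ "f' b"])
  then show "(\<lambda>\<zeta>. f (a + \<zeta> *s b)) field_differentiable at \<zeta> within {\<zeta>. a + \<zeta> *s b \<in> S}"
    using field_differentiable_at_within field_differentiable_def by blast
qed

lemma holomorphic_several_on_imp_continuous_on:
  assumes "f holomorphic_several_on S"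
  shows "continuous_on S f"
  using assms unfolding holomorphic_several_on_def
  by (intro continuous_at_imp_continuous_on) (blast intro: has_derivative_continuous)

lemma continuous_on_vector_scale [continuous_intros]:
  fixes g :: "'a :: topological_space \<Rightarrow> complex ^ 'n"
  assumes "continuous_on A f" "continuous_on A g"
  shows "continuous_on A (\<lambda>x. f x *s g x)"
  unfolding vector_scalar_mult_def using assms by (intro continuous_intros)

theorem sum_norm_gateaux_holomorphic_eq_0:
  fixes G :: "'k \<Rightarrow> complex ^ 'n \<Rightarrow> complex" and c :: "'k \<Rightarrow> real"
  assumes S: "open S" "convex S" and "finite K"
    and hol: "\<And>k. k \<in> K \<Longrightarrow> G k gateaux_holomorphic_on S"
    and V: "open V" "V \<noteq> {}" "V \<subseteq> S"
    and vanishes: "\<And>z. z \<in> V \<Longrightarrow> (\<Sum>k\<in>K. c k * cmod (G k z)) = 0"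
    and "p \<in> S"
  shows "(\<Sum>k\<in>K. c k * cmod (G k p)) = 0"
proof -
  obtain a where "a \<in> V"
    using V(2) by blast
  define line where "line \<zeta> = a + \<zeta> *s (p - a)" for \<zeta>
  have endpoints: "line 0 = a" "line 1 = p"
    by (simp_all add: line_def)
  have line_cont: "continuous_on UNIV line"
    unfolding line_def by (intro continuous_intros)
  have "(\<Sum>k\<in>K. c k * cmod (G k (line 1))) = 0"
  proof (rule sum_norm_holomorphic_eq_0[where S = "line -` S" and V = "line -` V"])
    show "open (line -` S)" "open (line -` V)"
      using S(1) V(1) line_cont by (auto intro: open_vimage)
    show "connected (line -` S)"
      unfolding line_def
      by (intro convex_connected convex_affine_vimage S(2) linear_vector_scale)
    show "(\<lambda>\<zeta>. G k (line \<zeta>)) holomorphic_on line -` S" if "k \<in> K" for k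
      unfolding line_def by (rule gateaux_holomorphic_onD[OF hol[OF that]]) simp
    show "line -` V \<noteq> {}"
      using \<open>a \<in> V\<close> endpoints by blast
  qed (use \<open>finite K\<close> V(3) vanishes \<open>p \<in> S\<close> endpoints in auto)
  then show ?thesis
    unfolding endpoints .
qed

section \<open>Partial derivatives are holomorphic along complex lines\<close>

lemma holomorphic_on_pointwise_limit:
  fixes F :: "nat \<Rightarrow> complex \<Rightarrow> complex"
  assumes "open S" and hol: "\<And>n. F n holomorphic_on S"
    and bounded: "\<And>K. compact K \<Longrightarrow> K \<subseteq> S \<Longrightarrow> \<exists>B. \<forall>n. \<forall>z\<in>K. cmod (F n z) \<le> B"
    and lim: "\<And>z. z \<in> S \<Longrightarrow> (\<lambda>n. F n z) \<longlonglongrightarrow> g z"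
  shows "g holomorphic_on S"
proof -
  obtain h k where h: "h holomorphic_on S" and "strict_mono (k :: nat \<Rightarrow> nat)"
    and sublim: "\<And>z. z \<in> S \<Longrightarrow> (\<lambda>n. F (k n) z) \<longlonglongrightarrow> h z"
    by (rule Montel[of S "range F" F]) (use \<open>open S\<close> hol bounded in auto)
  have "h z = g z" if "z \<in> S" for z
    using LIMSEQ_unique[OF sublim[OF that]] LIMSEQ_subseq_LIMSEQ[OF lim[OF that] \<open>strict_mono k\<close>]
    by (simp add: o_def)
  with h show ?thesis
    by (rule holomorphic_transform)
qed

lemma norm_diff_le_of_bounded_holomorphic:
  assumes hol: "G holomorphic_on ball c (2 * r)"
    and bounded: "\<And>w. w \<in> ball c (2 * r) \<Longrightarrow> cmod (G w) \<le> B"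
    and t: "t \<in> ball c r"
  shows "cmod (G t - G c) \<le> 2 * B / r * cmod (t - c)"
proof -
  have "0 < r"
    using t zero_le_dist[of c t] by (simp del: zero_le_dist)
  have deriv_le: "cmod (deriv G w) \<le> 2 * B / r" if "w \<in> ball c r" for w
  proof -
    have sub: "cball w (r / 2) \<subseteq> ball c (2 * r)"
      using that \<open>0 < r\<close> by (intro cball_subset_ball_iff[THEN iffD2]) (auto simp: dist_commute)
    have "cmod ((deriv ^^ 1) G w) \<le> fact 1 * B / (r / 2) ^ 1"
    proof (rule Cauchy_inequality)
      show "G holomorphic_on ball w (r / 2)"
        using hol sub ball_subset_cball holomorphic_on_subset by blast
      show "continuous_on (cball w (r / 2)) G"
        using hol sub holomorphic_on_imp_continuous_on continuous_on_subset by blast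
      show "cmod (G x) \<le> B" if "cmod (w - x) = r / 2" for x
        using that sub bounded by (auto simp: dist_norm subset_iff)
    qed (use \<open>0 < r\<close> in auto)
    then show ?thesis
      by (simp add: mult.commute)
  qed
  show ?thesis
  proof (rule field_differentiable_bound[where S = "ball c r" and f' = "deriv G"])
    show "(G has_field_derivative deriv G w) (at w within ball c r)" if "w \<in> ball c r" for w
      using that \<open>0 < r\<close> by (intro DERIV_subset[OF holomorphic_derivI[OF hol]]) auto
  qed (use deriv_le t \<open>0 < r\<close> in auto)
qed

lemma holomorphic_on_deriv_parameter:
  fixes F :: "complex \<Rightarrow> complex \<Rightarrow> complex"
  assumes "open U" "0 < R"
    and hol_parameter: "\<And>w. w \<in> ball c R \<Longrightarrow> (\<lambda>\<zeta>. F \<zeta> w) holomorphic_on U"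
    and hol: "\<And>\<zeta>. \<zeta> \<in> U \<Longrightarrow> F \<zeta> holomorphic_on ball c R"
    and bounded: "\<And>\<zeta> w. \<zeta> \<in> U \<Longrightarrow> w \<in> ball c R \<Longrightarrow> cmod (F \<zeta> w) \<le> B"
  shows "(\<lambda>\<zeta>. deriv (F \<zeta>) c) holomorphic_on U"
proof -
  obtain t where t: "\<And>n :: nat. t n \<in> ball c (R / 2)" "\<And>n. t n \<noteq> c" and t_lim: "t \<longlonglongrightarrow> c"
    using islimpt_sequential[of c "ball c (R / 2)"] \<open>0 < R\<close> by (auto simp: islimpt_ball)
  define Q where "Q n \<zeta> = (F \<zeta> (t n) - F \<zeta> c) / (t n - c)" for n \<zeta>
  show ?thesis
    using \<open>open U\<close>
  proof (rule holomorphic_on_pointwise_limit)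
    show "Q n holomorphic_on U" for n
      unfolding Q_def using t[of n] \<open>0 < R\<close>
      by (intro holomorphic_intros hol_parameter) auto
    have "cmod (Q n \<zeta>) \<le> 2 * B / (R / 2)" if "\<zeta> \<in> U" for n \<zeta>
      using norm_diff_le_of_bounded_holomorphic[of "F \<zeta>" c "R / 2" B "t n"] hol bounded t[of n] that
      by (simp add: Q_def norm_divide pos_divide_le_eq)
    then show "\<exists>B. \<forall>n. \<forall>\<zeta>\<in>K. cmod (Q n \<zeta>) \<le> B" if "K \<subseteq> U" for K
      using that by blast
    show "(\<lambda>n. Q n \<zeta>) \<longlonglongrightarrow> deriv (F \<zeta>) c" if "\<zeta> \<in> U" for \<zeta>
    proof -
      have "(F \<zeta> has_field_derivative deriv (F \<zeta>) c) (at c)"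
        using holomorphic_derivI[OF hol[OF that] open_ball] \<open>0 < R\<close> by simp
      moreover have "filterlim t (at c) sequentially"
        using t_lim t(2) by (simp add: filterlim_at)
      ultimately show ?thesis
        unfolding Q_def has_field_derivative_iff by (rule filterlim_compose)
    qed
  qed
qed

lemma partial_deriv_eq_deriv_line: "partial_deriv i f z = deriv (\<lambda>w. f (z + w *s axis i 1)) 0"
proof -
  have "(\<chi> j. if j = i then z $ i + w else z $ j) = z + w *s axis i 1" for w
    by (auto simp: vec_eq_iff axis_def)
  then show ?thesis
    by (simp add: partial_deriv_def deriv_shift_0[of _ "z $ i"] o_def)
qed

lemma continuous_on_open_locally_bounded:
  fixes f :: "'a :: topological_space \<Rightarrow> 'b :: real_normed_vector"
  assumes "open S" "continuous_on S f" "x \<in> S"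
  obtains T B where "open T" "x \<in> T" "T \<subseteq> S" "\<And>y. y \<in> T \<Longrightarrow> norm (f y) \<le> B"
proof
  show "open (S \<inter> f -` ball 0 (norm (f x) + 1))"
    using assms by (intro continuous_open_preimage) auto
  show "norm (f y) \<le> norm (f x) + 1" if "y \<in> S \<inter> f -` ball 0 (norm (f x) + 1)" for y
    using that by simp
qed (use \<open>x \<in> S\<close> in auto)

lemma gateaux_holomorphic_on_partial_deriv:
  fixes f :: "complex ^ 'n \<Rightarrow> complex"
  assumes "open S" "continuous_on S f" and hol: "f gateaux_holomorphic_on S"
  shows "partial_deriv i f gateaux_holomorphic_on S"
  unfolding gateaux_holomorphic_on_def holomorphic_on_def
proof (intro allI ballI)
  fix a b :: "complex ^ 'n" and \<zeta>\<^sub>0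
  define P where "P \<zeta> w = a + \<zeta> *s b + w *s axis i 1" for \<zeta> w
  assume "\<zeta>\<^sub>0 \<in> {\<zeta>. a + \<zeta> *s b \<in> S}"
  then have "P \<zeta>\<^sub>0 0 \<in> S"
    by (simp add: P_def)
  with assms(1,2) obtain T B where "open T" "P \<zeta>\<^sub>0 0 \<in> T" "T \<subseteq> S"
    and B: "\<And>z. z \<in> T \<Longrightarrow> cmod (f z) \<le> B"
    by (rule continuous_on_open_locally_bounded) blast
  have "continuous_on UNIV (\<lambda>(\<zeta>, w). P \<zeta> w)"
    unfolding P_def case_prod_unfold by (intro continuous_intros)
  with \<open>open T\<close> have "open ((\<lambda>(\<zeta>, w). P \<zeta> w) -` T)"
    by (rule open_vimage)
  moreover have "(\<zeta>\<^sub>0, 0) \<in> (\<lambda>(\<zeta>, w). P \<zeta> w) -` T"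
    using \<open>P \<zeta>\<^sub>0 0 \<in> T\<close> by simp
  ultimately obtain U W where U: "open U" "\<zeta>\<^sub>0 \<in> U" and "open W" "0 \<in> W"
    and UW_subset: "U \<times> W \<subseteq> (\<lambda>(\<zeta>, w). P \<zeta> w) -` T"
    by (elim open_prod_elim) auto
  then obtain R where "0 < R" and R: "ball 0 R \<subseteq> W"
    using openE by blast
  have P_in_T: "P \<zeta> w \<in> T" if "\<zeta> \<in> U" "w \<in> ball 0 R" for \<zeta> w
    using subsetD[OF UW_subset, of "(\<zeta>, w)"] subsetD[OF R] that by simp
  have "(\<lambda>\<zeta>. deriv (\<lambda>w. f (P \<zeta> w)) 0) holomorphic_on U"
  proof (rule holomorphic_on_deriv_parameter[OF U(1) \<open>0 < R\<close>])
    show "(\<lambda>w. f (P \<zeta> w)) holomorphic_on ball 0 R" if "\<zeta> \<in> U" for \<zeta>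
      using P_in_T[OF that] \<open>T \<subseteq> S\<close> unfolding P_def
      by (intro gateaux_holomorphic_onD[OF hol]) auto
    have P_eq: "P \<zeta> w = (a + w *s axis i 1) + \<zeta> *s b" for \<zeta> w
      by (simp add: P_def)
    show "(\<lambda>\<zeta>. f (P \<zeta> w)) holomorphic_on U" if "w \<in> ball 0 R" for w
      using P_in_T[OF _ that] \<open>T \<subseteq> S\<close> unfolding P_eq
      by (intro gateaux_holomorphic_onD[OF hol]) auto
  qed (use P_in_T B in auto)
  then have "(\<lambda>\<zeta>. partial_deriv i f (a + \<zeta> *s b)) holomorphic_on U"
    by (simp add: partial_deriv_eq_deriv_line P_def)
  then show "(\<lambda>\<zeta>. partial_deriv i f (a + \<zeta> *s b)) field_differentiable
      at \<zeta>\<^sub>0 within {\<zeta>. a + \<zeta> *s b \<in> S}"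
    using U by (rule field_differentiable_at_within[OF holomorphic_on_imp_differentiable_at])
qed

section \<open>Extreme sets\<close>

lemma extremal_identity_extends:
  fixes h :: "complex ^ 'n \<Rightarrow> complex" and l g :: "'i \<Rightarrow> complex ^ 'n \<Rightarrow> complex"
  assumes S: "open S" "convex S" and "finite I"
    and h: "h gateaux_holomorphic_on S"
    and l: "\<And>i. i \<in> I \<Longrightarrow> l i gateaux_holomorphic_on S"
    and g: "\<And>i. i \<in> I \<Longrightarrow> g i gateaux_holomorphic_on S"
    and V: "open V" "V \<noteq> {}" "V \<subseteq> S"
    and eq: "\<And>z. z \<in> V \<Longrightarrow>
      1 - (cmod (h z))\<^sup>2 = (\<Sum>i\<in>I. (1 - (cmod (l i z))\<^sup>2) * cmod (g i z))"
    and "p \<in> S"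
  shows "1 - (cmod (h p))\<^sup>2 = (\<Sum>i\<in>I. (1 - (cmod (l i p))\<^sup>2) * cmod (g i p))"
proof -
  define K where "K = (UNIV :: bool set) <+> I <+> I"
  define c :: "bool + 'i + 'i \<Rightarrow> real" where
    "c = case_sum (case_bool 1 (- 1)) (case_sum (\<lambda>_. - 1) (\<lambda>_. 1))"
  define G where "G = case_sum (case_bool (\<lambda>_. 1) (\<lambda>z. (h z)\<^sup>2))
    (case_sum g (\<lambda>i z. (l i z)\<^sup>2 * g i z))"
  have sum_eq: "(\<Sum>k\<in>K. c k * cmod (G k z)) =
      1 - (cmod (h z))\<^sup>2 - (\<Sum>i\<in>I. (1 - (cmod (l i z))\<^sup>2) * cmod (g i z))" for z
    using \<open>finite I\<close>
    by (simp add: K_def c_def G_def sum.Plus UNIV_bool o_def norm_mult norm_power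
        left_diff_distrib sum_subtractf sum_negf)
  have "(\<Sum>k\<in>K. c k * cmod (G k p)) = 0"
    using S _ _ V _ \<open>p \<in> S\<close>
  proof (rule sum_norm_gateaux_holomorphic_eq_0)
    show "finite K"
      using \<open>finite I\<close> by (simp add: K_def)
    show "G k gateaux_holomorphic_on S" if "k \<in> K" for k
      using that h l g unfolding K_def G_def
      by (auto intro!: gateaux_holomorphic_on_const gateaux_holomorphic_on_mult
          gateaux_holomorphic_on_power split: bool.splits)
    show "(\<Sum>k\<in>K. c k * cmod (G k z)) = 0" if "z \<in> V" for z
      using eq[OF that] by (simp add: sum_eq)
  qed
  then show ?thesis
    by (simp add: sum_eq)
qed

lemma polydisk_eq_INT: "polydisk = (\<Inter>i. (\<lambda>z. z $ i) -` ball 0 1)"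
  by (auto simp: polydisk_def)

lemma open_polydisk: "open (polydisk :: (complex ^ 'n) set)"
  unfolding polydisk_eq_INT by (intro open_INT ballI open_vimage open_ball continuous_intros) simp

lemma convex_polydisk: "convex (polydisk :: (complex ^ 'n) set)"
  unfolding polydisk_eq_INT
  by (intro convex_INT convex_linear_vimage convex_ball bounded_linear.linear
      bounded_linear_vec_nth)

theorem theorem1p8:
  fixes f :: "complex ^ 'n \<Rightarrow> complex"
  assumes "f holomorphic_several_on polydisk"
    and "f ` polydisk \<subseteq> ball 0 1"
    and "interior (extreme_set f) \<noteq> {}"
  shows "everywhere_infinitesimally_extremal f"
proof -
  have f: "f gateaux_holomorphic_on polydisk"
    using assms(1) by (rule holomorphic_several_on_imp_gateaux_holomorphic_on)
  have partials: "partial_deriv i f gateaux_holomorphic_on polydisk" for i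
    using open_polydisk holomorphic_several_on_imp_continuous_on[OF assms(1)] f
    by (rule gateaux_holomorphic_on_partial_deriv)
  have interior: "interior (extreme_set f) \<subseteq> extreme_set f"
    by (rule interior_subset)
  have "1 - (cmod (f p))\<^sup>2 = (\<Sum>i\<in>UNIV. (1 - (cmod (p $ i))\<^sup>2) * cmod (partial_deriv i f p))"
    if "p \<in> polydisk" for p
    using open_polydisk convex_polydisk finite f gateaux_holomorphic_on_nth partials
      open_interior assms(3) _ _ that
    by (rule extremal_identity_extends) (use interior in \<open>auto simp: extreme_set_def\<close>)
  then show ?thesis
    by (auto simp: everywhere_infinitesimally_extremal_def extreme_set_def)
qed

end
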